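(* Let $d\ge 1$ and let $p$ be a monic polynomial of degree $d$ all of whose roots are non-negative real numbers. Let $\Lambda$ be the multiset of its $d$ roots and let $k$ be the number of zeros in $\Lambda$ (counted with multiplicity). For $n\in\mathbb{N}$, $n\ge1$, let $\lambda_1^{(n)}\ge\lambda_2^{(n)}\ge\dots\ge\lambda_d^{(n)}$ be the (non-negative real) roots of $p^{\boxtimes_d n}$, listed with multiplicity. Then $$\lim_{n\to\infty}\big(\lambda_i^{(n)}\big)^{\frac1n}=\frac{\widetilde e_i(\Lambda)}{\widetilde e_{i-1}(\Lambda)}\qquad\text{for } 1\le i\le d-k,$$ and $$\lim_{n\to\infty}\big(\lambda_i^{(n)}\big)^{\frac1n}=0\qquad\text{for } d-k+1\le i\le d.$$
   Context: For monic polynomials $p(x)=\sum_{i=0}^d(-1)^ip_ix^{d-i}$ and $q(x)=\sum_{i=0}^d(-1)^iq_ix^{d-i}$ of degree $d$ having only non-negative real roots, the finite free multiplicative convolution is $$(p\boxtimes_d q)(x):=\sum_{i=0}^d(-1)^i\frac{p_iq_i}{\binom di}x^{d-i}.$$ It is a known fact that $p\boxtimes_d q$ is again a monic polynomial of degree $d$ with only non-negative real roots. The polynomial $p^{\boxtimes_d n}$ denotes the $n$-th power of $p$ under $\boxtimes_d$, i.e. $p^{\boxtimes_d 1}=p$ and $p^{\boxtimes_d (n+1)}=p^{\boxtimes_d n}\boxtimes_d p$. For a finite multiset $\Lambda=\{\lambda_1,\dots,\lambda_d\}$ of complex numbers, with $[d]=\{1,\dots,d\}$, the elementary symmetric polynomials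 are $e_i(\Lambda):=\sum_{J\subset[d],\,|J|=i}\prod_{j\in J}\lambda_j$, $e_0(\Lambda):=1$, and their normalized versions are $\widetilde e_i(\Lambda):=e_i(\Lambda)/\binom di$ for $0\le i\le d$. *)

theory Defs
  imports Complex_Main "HOL-Computational_Algebra.Polynomial"
    "HOL-Combinatorics.Permutations" "HOL-Library.Nonpos_Ints"
begin

text \<open>All complex roots are non-negative reals. A monic polynomial with this property over the
  complex numbers has real coefficients, so nothing is lost by taking \<^typ>\<open>real poly\<close>; then
  \<^term>\<open>proots p\<close> has \<^term>\<open>degree p\<close> elements.\<close>

definition nonneg_real_rooted :: "real poly \<Rightarrow> bool" where
  "nonneg_real_rooted p \<longleftrightarrow>
     (\<forall>z::complex. poly (map_poly complex_of_real p) z = 0 \<longrightarrow> z \<in> \<real>\<^sub>\<ge>\<^sub>0)"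

text \<open>The numbers \<open>p\<^sub>i\<close> in \<open>p(x) = \<Sum>i\<le>d. (-1)^i * p\<^sub>i * x^(d-i)\<close>.\<close>

definition signed_coeff :: "nat \<Rightarrow> 'a::comm_ring_1 poly \<Rightarrow> nat \<Rightarrow> 'a" where
  "signed_coeff d p i = (-1) ^ i * coeff p (d - i)"

definition ff_mult_conv :: "nat \<Rightarrow> 'a::field_char_0 poly \<Rightarrow> 'a poly \<Rightarrow> 'a poly" where
  "ff_mult_conv d p q =
     (\<Sum>i=0..d. monom ((-1) ^ i * (signed_coeff d p i * signed_coeff d q i / of_nat (d choose i)))
                      (d - i))"

text \<open>The value at \<open>0\<close> is the unit \<open>(x - 1)^d\<close> of the convolution; it plays no role in limits.\<close>

fun ff_mult_power :: "nat \<Rightarrow> 'a::field_char_0 poly \<Rightarrow> nat \<Rightarrow> 'a poly" where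
  "ff_mult_power d p 0 = [:-1, 1:] ^ d"
| "ff_mult_power d p (Suc 0) = p"
| "ff_mult_power d p (Suc (Suc n)) = ff_mult_conv d (ff_mult_power d p (Suc n)) p"

text \<open>The \<open>i\<close>-th largest real root counted with multiplicity, for \<open>1 \<le> i \<le> d\<close> where \<open>d\<close> is the
  number of real roots; unspecified for other \<open>i\<close>.\<close>

definition desc_root :: "real poly \<Rightarrow> nat \<Rightarrow> real" where
  "desc_root p i = rev (sorted_list_of_multiset (proots p)) ! (i - 1)"

text \<open>The multiset is enumerated in an arbitrary order; the lemma below shows that the order does
  not matter. The index set \<open>{1..d}\<close> is shifted to \<open>{0..<d}\<close>.\<close>

definition esym :: "nat \<Rightarrow> 'a::comm_ring_1 multiset \<Rightarrow> 'a" where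
  "esym i M = (let xs = (SOME xs. mset xs = M) in
     \<Sum>J | J \<subseteq> {0..<length xs} \<and> card J = i. \<Prod>j\<in>J. xs ! j)"

lemma esym_mset:
  "esym i (mset xs) = (\<Sum>J | J \<subseteq> {0..<length xs} \<and> card J = i. \<Prod>j\<in>J. xs ! j)"
proof -
  define ys where "ys = (SOME ys. mset ys = mset xs)"
  have ys: "mset ys = mset xs"
    unfolding ys_def by (rule someI) (rule refl)
  then have len: "length ys = length xs"
    by (rule mset_eq_length)
  obtain f where f: "f permutes {..<length xs}" and perm: "permute_list f xs = ys"
    using mset_eq_permutation[OF ys] by blast
  let ?A = "{J. J \<subseteq> {0..<length xs} \<and> card J = i}"
  have inj: "inj f" and im: "f ` {0..<length xs} = {0..<length xs}"
    using permutes_inj[OF f] permutes_image[OF f] by (auto simp: atLeast0LessThan)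
  have bij: "bij_betw (image f) ?A ?A"
  proof (rule bij_betw_byWitness[where f' = "image (inv f)"])
    show "\<forall>J\<in>?A. inv f ` f ` J = J"
      using inj by (simp add: image_inv_f_f)
    show "\<forall>J\<in>?A. f ` inv f ` J = J"
      using permutes_surj[OF f] by (simp add: image_f_inv_f)
    show "image f ` ?A \<subseteq> ?A"
      using im inj by (auto simp: card_image inj_on_subset)
    have "inv f ` {0..<length xs} = {0..<length xs}" "inj (inv f)"
      using permutes_image[OF permutes_inv[OF f]] permutes_inj[OF permutes_inv[OF f]]
      by (auto simp: atLeast0LessThan)
    then show "image (inv f) ` ?A \<subseteq> ?A"
      by (auto simp: card_image inj_on_subset)
  qed
  have "esym i (mset xs) = (\<Sum>J\<in>?A. \<Prod>j\<in>J. ys ! j)"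
    unfolding esym_def ys_def[symmetric] Let_def len ..
  also have "\<dots> = (\<Sum>J\<in>?A. \<Prod>j\<in>f ` J. xs ! j)"
  proof (rule sum.cong[OF refl])
    fix J assume J: "J \<in> ?A"
    have "(\<Prod>j\<in>J. ys ! j) = (\<Prod>j\<in>J. xs ! f j)"
      using J f by (intro prod.cong) (auto simp: permute_list_nth simp flip: perm)
    also have "\<dots> = (\<Prod>j\<in>f ` J. xs ! j)"
      using inj by (subst prod.reindex) (auto simp: inj_on_def)
    finally show "(\<Prod>j\<in>J. ys ! j) = (\<Prod>j\<in>f ` J. xs ! j)" .
  qed
  also have "\<dots> = (\<Sum>J\<in>?A. \<Prod>j\<in>J. xs ! j)"
    by (rule sum.reindex_bij_betw[OF bij])
  finally show ?thesis .
qed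

definition norm_esym :: "nat \<Rightarrow> 'a::field_char_0 multiset \<Rightarrow> 'a" where
  "norm_esym i M = esym i M / of_nat (size M choose i)"

end

theory Submission
  imports Defs "HOL-Computational_Algebra.Fundamental_Theorem_Algebra"
begin

text \<open>
  Write \<open>E\<^sub>i\<close> for the normalised elementary symmetric polynomials of the roots of \<open>p\<close> and
  \<open>m = d - k\<close> for the number of positive roots. By Vieta, the coefficients of \<open>p\<close> are
  \<open>(d choose i) * E\<^sub>i\<close> up to sign, so the convolution acts on the \<open>E\<^sub>i\<close> by plain multiplication
  and the \<open>n\<close>-th convolution power of \<open>p\<close> is
  \<open>P\<^sub>n(x) = (\<Sum>i\<le>d. (-1)^i * (d choose i) * E\<^sub>i^n * x^(d-i))\<close>.

  If the roots of \<open>p\<close> are not all equal, Newton's inequalities \<open>E\<^sub>i\<^sub>-\<^sub>1 * E\<^sub>i\<^sub>+\<^sub>1 < E\<^sub>i^2\<close> are strict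
  for \<open>1 \<le> i \<le> m\<close> (\<open>newton_ineq_strict\<close>), that is, the ratios \<open>r\<^sub>i = E\<^sub>i / E\<^sub>i\<^sub>-\<^sub>1\<close> decrease
  strictly: \<open>r\<^sub>1 > r\<^sub>2 > \<dots> > r\<^sub>m > 0\<close>. Choose separating points
  \<open>t\<^sub>0 > r\<^sub>1 > t\<^sub>1 > \<dots> > r\<^sub>m > t\<^sub>m > 0\<close>. At \<open>x = t\<^sub>i^n\<close> the \<open>j\<close>-th term of \<open>P\<^sub>n\<close> is, up to a factor
  independent of \<open>n\<close>, the \<open>n\<close>-th power of \<open>E\<^sub>j * t\<^sub>i^(d-j)\<close>, and the latter is largest exactly for
  \<open>j = i\<close> (\<open>separating_dominant\<close>). Hence for large \<open>n\<close> the sign of \<open>P\<^sub>n(t\<^sub>i^n)\<close> is \<open>(-1)^i\<close>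
  (\<open>dominant_term_sign\<close>), and \<open>P\<^sub>n\<close> has a root between \<open>t\<^sub>i^n\<close> and \<open>t\<^sub>i\<^sub>-\<^sub>1^n\<close> for each \<open>1 \<le> i \<le> m\<close>.
  Together with the \<open>k\<close>-fold root \<open>0\<close> these are all \<open>d\<close> roots
  (\<open>sign_changes_locate_roots\<close>). So the \<open>n\<close>-th root of the \<open>i\<close>-th largest root eventually lies
  between \<open>t\<^sub>i\<close> and \<open>t\<^sub>i\<^sub>-\<^sub>1\<close>, and both points can be chosen arbitrarily close to \<open>r\<^sub>i\<close>
  (\<open>tendsto_root_desc_root\<close>). In particular the argument itself shows that \<open>P\<^sub>n\<close> is real-rooted for
  large \<open>n\<close>.

  If all roots equal some \<open>a\<close>, then \<open>P\<^sub>n = (x - a^n)^d\<close> and the claim is immediate.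

  Newton's inequalities with their equality case are obtained by adding the roots one at a time:
  the defect \<open>E\<^sub>i^2 - E\<^sub>i\<^sub>-\<^sub>1 * E\<^sub>i\<^sub>+\<^sub>1\<close> after adding a root \<open>a\<close> is a combination with
  non-negative coefficients of earlier defects and of an analogous cross term, plus a square
  (\<open>norm_esym_add_mset_square_diff\<close>).
\<close>

section \<open>Elementary symmetric polynomials\<close>

lemma esym_0 [simp]: "esym 0 M = 1"
proof -
  obtain xs where xs: "M = mset xs" by (metis ex_mset)
  have "{J. J \<subseteq> {0..<length xs} \<and> card J = 0} = {{}}"
    by (auto dest: finite_subset)
  then show ?thesis by (simp add: xs esym_mset)
qed

lemma esym_eq_0_of_size_less:
  assumes "size M < i"
  shows "esym i M = 0"
proof -
  obtain xs where xs: "M = mset xs" by (metis ex_mset)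
  have "{J. J \<subseteq> {0..<length xs} \<and> card J = i} = {}"
    using assms by (auto simp: xs dest!: card_mono[rotated])
  then show ?thesis unfolding xs esym_mset by (simp only: sum.empty)
qed

text \<open>Sort the index sets \<open>J\<close> by whether they contain the index of \<open>a\<close>.\<close>

lemma esym_Suc_add_mset:
  "esym (Suc i) (add_mset a M) = esym (Suc i) M + a * esym i M"
proof -
  obtain xs where xs: "M = mset xs" by (metis ex_mset)
  let ?n = "length xs" and ?ys = "xs @ [a]"
  let ?S = "\<lambda>i. {J. J \<subseteq> {0..<?n} \<and> card J = i}"
  have fin: "finite (?S j)" for j
    by (rule finite_subset[of _ "Pow {0..<?n}"]) auto
  have split: "{J. J \<subseteq> {0..<length ?ys} \<and> card J = Suc i} = ?S (Suc i) \<union> insert ?n ` ?S i"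
    (is "?L = ?R")
  proof
    show "?R \<subseteq> ?L"
      by (auto simp: card_insert_if finite_subset[of _ "{0..<?n}"] subset_iff less_Suc_eq)
    show "?L \<subseteq> ?R"
    proof
      fix J assume J: "J \<in> ?L"
      then have fJ: "finite J" by (auto intro: finite_subset)
      show "J \<in> ?R"
      proof (cases "?n \<in> J")
        case True
        then have "J = insert ?n (J - {?n})" "J - {?n} \<in> ?S i"
          using J fJ by (auto simp: less_Suc_eq)
        then show ?thesis by blast
      next
        case False
        then have "J \<in> ?S (Suc i)" using J by (auto simp: subset_iff less_Suc_eq)
        then show ?thesis by blast
      qed
    qed
  qed
  have inj: "inj_on (insert ?n) (?S i)"
    by (rule inj_onI) (metis (mono_tags, lifting) atLeastLessThan_iff insert_ident
        less_irrefl mem_Collect_eq subsetD)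
  have "esym (Suc i) (mset ?ys) =
      (\<Sum>J\<in>?S (Suc i). \<Prod>j\<in>J. ?ys ! j) + (\<Sum>J\<in>insert ?n ` ?S i. \<Prod>j\<in>J. ?ys ! j)"
    unfolding esym_mset split by (rule sum.union_disjoint) (use fin in auto)
  also have "(\<Sum>J\<in>?S (Suc i). \<Prod>j\<in>J. ?ys ! j) = (\<Sum>J\<in>?S (Suc i). \<Prod>j\<in>J. xs ! j)"
    by (intro sum.cong prod.cong refl) (auto simp: nth_append subset_iff)
  also have "(\<Sum>J\<in>insert ?n ` ?S i. \<Prod>j\<in>J. ?ys ! j) = (\<Sum>J\<in>?S i. a * (\<Prod>j\<in>J. xs ! j))"
  proof (subst sum.reindex[OF inj], rule sum.cong[OF refl])
    fix J assume J: "J \<in> ?S i"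
    then have "finite J" "?n \<notin> J" by (auto intro: finite_subset)
    moreover have "(\<Prod>j\<in>J. ?ys ! j) = (\<Prod>j\<in>J. xs ! j)"
      using J by (intro prod.cong refl) (auto simp: nth_append subset_iff)
    ultimately show "((\<lambda>J. \<Prod>j\<in>J. ?ys ! j) \<circ> insert ?n) J = a * (\<Prod>j\<in>J. xs ! j)"
      by simp
  qed
  finally show ?thesis by (simp add: xs esym_mset sum_distrib_left)
qed

lemma esym_nonneg:
  fixes M :: "real multiset"
  assumes "\<forall>a\<in>#M. 0 \<le> a"
  shows "0 \<le> esym i M"
  using assms
proof (induction M arbitrary: i)
  case empty
  then show ?case by (cases i) (simp_all add: esym_eq_0_of_size_less)
next
  case (add a M)
  then show ?case by (cases i) (simp_all add: esym_Suc_add_mset)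
qed

text \<open>Only the products over index sets that avoid all zeros contribute, and such a set of size \<open>i\<close>
  exists exactly when there are at least \<open>i\<close> non-zero entries.\<close>

lemma esym_pos_iff:
  fixes M :: "real multiset"
  assumes "\<forall>a\<in>#M. 0 \<le> a"
  shows "0 < esym i M \<longleftrightarrow> i + count M 0 \<le> size M"
  using assms
proof (induction M arbitrary: i)
  case empty
  then show ?case by (cases i) (simp_all add: esym_eq_0_of_size_less)
next
  case (add a M)
  show ?case
  proof (cases i)
    case 0
    then show ?thesis using count_le_size[of "add_mset a M" 0] by simp
  next
    case (Suc j)
    have nn: "0 \<le> esym (Suc j) M" "0 \<le> esym j M" "0 \<le> a"
      using add.prems by (auto intro: esym_nonneg)
    have IH: "0 < esym (Suc j) M \<longleftrightarrow> Suc j + count M 0 \<le> size M"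
        "0 < esym j M \<longleftrightarrow> j + count M 0 \<le> size M"
      using add by auto
    show ?thesis
    proof (cases "a = 0")
      case True
      then show ?thesis using IH Suc by (simp add: esym_Suc_add_mset)
    next
      case False
      then have "0 < esym i (add_mset a M) \<longleftrightarrow> 0 < esym (Suc j) M \<or> 0 < esym j M"
        using nn Suc by (auto simp: esym_Suc_add_mset add_pos_nonneg add_nonneg_pos
            zero_less_mult_iff order_less_le add_nonneg_eq_0_iff)
      then show ?thesis using IH Suc False by auto
    qed
  qed
qed

lemma esym_replicate_mset:
  "esym i (replicate_mset n a) = of_nat (n choose i) * a ^ i"
proof (induction n arbitrary: i)
  case 0
  then show ?case by (cases i) (simp_all add: esym_eq_0_of_size_less)
next
  case (Suc n)
  then show ?case by (cases i) (simp_all add: esym_Suc_add_mset algebra_simps)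
qed

lemma norm_esym_0 [simp]: "norm_esym 0 M = 1"
  by (simp add: norm_esym_def)

lemma norm_esym_eq_0_of_size_less:
  "size M < i \<Longrightarrow> norm_esym i M = 0"
  by (simp add: norm_esym_def)

lemma esym_eq_choose_mult_norm_esym:
  "esym i M = of_nat (size M choose i) * norm_esym i M"
  by (cases "size M < i") (simp_all add: norm_esym_def esym_eq_0_of_size_less)

lemma norm_esym_replicate_mset:
  assumes "i \<le> n"
  shows "norm_esym i (replicate_mset n a) = a ^ i"
  using assms by (simp add: norm_esym_def esym_replicate_mset)

lemma norm_esym_nonneg:
  fixes M :: "real multiset"
  assumes "\<forall>a\<in>#M. 0 \<le> a"
  shows "0 \<le> norm_esym i M"
  using assms by (simp add: norm_esym_def esym_nonneg)

lemma norm_esym_pos_iff: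
  fixes M :: "real multiset"
  assumes "\<forall>a\<in>#M. 0 \<le> a"
  shows "0 < norm_esym i M \<longleftrightarrow> i + count M 0 \<le> size M"
  using esym_pos_iff[OF assms, of i]
  by (auto simp: norm_esym_def zero_less_divide_iff)

text \<open>This is the recursion of \<^const>\<open>esym\<close> after normalisation: the new \<open>i\<close>-th value is the average
  of \<open>norm_esym i M\<close> and \<open>a * norm_esym (i - 1) M\<close> with weights \<open>1 - i / (size M + 1)\<close> and
  \<open>i / (size M + 1)\<close>. For \<open>i = 0\<close> the truncated index \<open>i - 1\<close> is harmless, since its weight is \<open>0\<close>.\<close>

lemma norm_esym_add_mset:
  fixes M :: "real multiset"
  shows "(real (size M) + 1) * norm_esym i (add_mset a M) =
    (real (size M) + 1 - real i) * norm_esym i M + real i * a * norm_esym (i - 1) M"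
proof (cases i)
  case 0
  then show ?thesis by simp
next
  case (Suc j)
  let ?n = "size M"
  show ?thesis
  proof (cases "j \<le> ?n")
    case False
    then show ?thesis by (simp add: Suc norm_esym_eq_0_of_size_less)
  next
    case True
    let ?C = "real (Suc ?n choose Suc j)"
    have C: "?C \<noteq> 0" using True by (simp del: binomial_Suc_Suc)
    have absorb1: "(real ?n - real j) * ?C = (real ?n + 1) * real (?n choose Suc j)"
    proof -
      have "(Suc ?n - Suc j) * (Suc ?n choose Suc j) = Suc ?n * (?n choose Suc j)"
        using binomial_absorb_comp[of "Suc ?n" "Suc j"] by simp
      then have "real (Suc ?n - Suc j) * ?C = real (Suc ?n) * real (?n choose Suc j)"
        by (metis of_nat_mult)
      then show ?thesis using True by (simp add: of_nat_diff algebra_simps)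
    qed
    have absorb2: "(real j + 1) * ?C = (real ?n + 1) * real (?n choose j)"
    proof -
      have "real (Suc j) * ?C = real (Suc ?n) * real (?n choose j)"
        by (metis Suc_times_binomial_eq mult.commute of_nat_mult)
      then show ?thesis by (simp add: algebra_simps)
    qed
    have "(real ?n + 1) * norm_esym i (add_mset a M) * ?C = (real ?n + 1) * esym i (add_mset a M)"
      using C by (simp add: norm_esym_def Suc del: binomial_Suc_Suc)
    also have "\<dots> = (real ?n + 1) * real (?n choose Suc j) * norm_esym (Suc j) M
        + (real ?n + 1) * real (?n choose j) * a * norm_esym j M"
      unfolding Suc esym_Suc_add_mset
      by (simp add: esym_eq_choose_mult_norm_esym algebra_simps)
    also have "\<dots> = ((real ?n + 1 - real i) * norm_esym i M + real i * a * norm_esym (i - 1) M) * ?C"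
      unfolding absorb1[symmetric] absorb2[symmetric]
      by (simp add: Suc algebra_simps del: binomial_Suc_Suc)
    finally show ?thesis by (rule mult_right_cancel[OF C, THEN iffD1])
  qed
qed

section \<open>Newton's inequalities\<close>

text \<open>Here the induction for Newton's inequalities happens. The left side is the Newton defect
  after adding the entry \<open>a\<close>; on the right stand Newton defects of \<open>M\<close>, the cross term
  treated in \<open>newton_cross_ineq\<close>, and a square. The square is what is left over from the terms
  \<open>(E (Suc j))\<^sup>2\<close>, \<open>a * E j * E (Suc j)\<close> and \<open>a\<^sup>2 * (E j)\<^sup>2\<close>; it provides
  strictness when \<open>M\<close> is constant, where all other terms vanish. The term with the truncated
  index \<open>j - 1\<close> always carries the factor \<open>j\<close>.\<close>

lemma norm_esym_add_mset_square_diff: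
  fixes M :: "real multiset" and a :: real and j :: nat
  defines "E \<equiv> \<lambda>i. norm_esym i M" and "F \<equiv> \<lambda>i. norm_esym i (add_mset a M)"
  defines "N \<equiv> real (size M) - real j"
  shows "(real (size M) + 1)\<^sup>2 * ((F (Suc j))\<^sup>2 - F j * F (Suc (Suc j))) =
      (N\<^sup>2 - 1) * ((E (Suc j))\<^sup>2 - E j * E (Suc (Suc j)))
      + real j * (N - 1) * a * (E j * E (Suc j) - E (j - 1) * E (Suc (Suc j)))
      + real j * (real j + 2) * a\<^sup>2 * ((E j)\<^sup>2 - E (j - 1) * E (Suc j))
      + (E (Suc j) - a * E j)\<^sup>2"
proof -
  let ?n = "real (size M) + 1"
  have rec: "?n * F j = (N + 1) * E j + real j * a * E (j - 1)"
    "?n * F (Suc j) = N * E (Suc j) + (real j + 1) * a * E j"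
    "?n * F (Suc (Suc j)) = (N - 1) * E (Suc (Suc j)) + (real j + 2) * a * E (Suc j)"
    using norm_esym_add_mset[of M j a] norm_esym_add_mset[of M "Suc j" a]
      norm_esym_add_mset[of M "Suc (Suc j)" a]
    by (simp_all add: E_def F_def N_def algebra_simps)
  have "?n\<^sup>2 * ((F (Suc j))\<^sup>2 - F j * F (Suc (Suc j))) =
      (?n * F (Suc j))\<^sup>2 - (?n * F j) * (?n * F (Suc (Suc j)))"
    by (simp add: power2_eq_square algebra_simps)
  then show ?thesis unfolding rec by (simp add: power2_eq_square algebra_simps)
qed

text \<open>Two consecutive Newton inequalities multiply to \<open>a * d * (b * c) \<le> (b * c)\<^sup>2\<close>. Dividing by
  \<open>b * c\<close> is impossible if it is \<open>0\<close>; then the last two hypotheses take over, which hold for the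
  \<^const>\<open>norm_esym\<close> because these stay \<open>0\<close> once they are \<open>0\<close>.\<close>

lemma newton_cross_ineq:
  fixes a b c d :: real
  assumes "0 \<le> a" "0 \<le> b" "0 \<le> c" "0 \<le> d"
    and "a * c \<le> b\<^sup>2" "b * d \<le> c\<^sup>2" "b = 0 \<Longrightarrow> d = 0" "c = 0 \<Longrightarrow> d = 0"
  shows "a * d \<le> b * c"
proof (cases "b = 0 \<or> c = 0")
  case True
  then show ?thesis using assms by auto
next
  case False
  then have "0 < b * c" using assms by auto
  moreover have "(a * c) * (b * d) \<le> b\<^sup>2 * c\<^sup>2"
    using assms by (intro mult_mono) auto
  then have "(b * c) * (a * d) \<le> (b * c) * (b * c)"
    by (simp add: power2_eq_square algebra_simps)
  ultimately show ?thesis by (metis mult_le_cancel_left_pos)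
qed

lemma norm_esym_eq_0_mono:
  fixes M :: "real multiset"
  assumes "\<forall>a\<in>#M. 0 \<le> a" "i \<le> j" "norm_esym i M = 0"
  shows "norm_esym j M = 0"
  using norm_esym_pos_iff[OF assms(1), of i] norm_esym_pos_iff[OF assms(1), of j]
    norm_esym_nonneg[OF assms(1), of j] assms(2,3) by auto

text \<open>The step that the weak and the strict inequality share. The cross term is dropped, because it is
  non-negative as soon as \<open>M\<close> satisfies the weak inequalities.\<close>

lemma norm_esym_add_mset_square_diff_ge:
  fixes M :: "real multiset" and a :: real and j :: nat
  defines "E \<equiv> \<lambda>i. norm_esym i M" and "F \<equiv> \<lambda>i. norm_esym i (add_mset a M)"
  defines "N \<equiv> real (size M) - real j"
  assumes nn: "\<forall>b\<in>#M. 0 \<le> b" "0 \<le> a"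
    and newton: "\<And>j. E j * E (Suc (Suc j)) \<le> (E (Suc j))\<^sup>2"
    and j: "Suc j \<le> size M"
  shows "(N\<^sup>2 - 1) * ((E (Suc j))\<^sup>2 - E j * E (Suc (Suc j)))
      + real j * (real j + 2) * a\<^sup>2 * ((E j)\<^sup>2 - E (j - 1) * E (Suc j))
      + (E (Suc j) - a * E j)\<^sup>2
    \<le> (real (size M) + 1)\<^sup>2 * ((F (Suc j))\<^sup>2 - F j * F (Suc (Suc j)))"
proof -
  have cross: "0 \<le> real j * (E j * E (Suc j) - E (j - 1) * E (Suc (Suc j)))"
  proof (cases j)
    case (Suc l)
    have "E l * E (Suc (Suc j)) \<le> E j * E (Suc j)"
      using newton[of l] newton[of j] nn(1)
      by (intro newton_cross_ineq)
        (auto simp: E_def Suc norm_esym_nonneg intro: norm_esym_eq_0_mono[rotated 2])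
    then show ?thesis by (simp add: Suc)
  qed simp
  have "0 \<le> (N - 1) * a"
    using j nn(2) by (simp add: N_def)
  then have "0 \<le> ((N - 1) * a) * (real j * (E j * E (Suc j) - E (j - 1) * E (Suc (Suc j))))"
    using cross by (rule mult_nonneg_nonneg)
  then show ?thesis
    using norm_esym_add_mset_square_diff[where M = M and a = a and j = j]
    unfolding E_def F_def N_def[symmetric] by (simp add: mult_ac)
qed

theorem newton_ineq:
  fixes M :: "real multiset"
  assumes "\<forall>a\<in>#M. 0 \<le> a"
  shows "norm_esym j M * norm_esym (Suc (Suc j)) M \<le> (norm_esym (Suc j) M)\<^sup>2"
  using assms
proof (induction M arbitrary: j)
  case empty
  then show ?case by (simp add: norm_esym_eq_0_of_size_less)
next
  case (add a M)
  let ?E = "\<lambda>i. norm_esym i M" and ?F = "\<lambda>i. norm_esym i (add_mset a M)"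
  have nn: "\<forall>b\<in>#M. 0 \<le> b" "0 \<le> a" using add.prems by auto
  note IH = add.IH[OF nn(1)]
  show ?case
  proof (cases "Suc j \<le> size M")
    case False
    then show ?thesis by (simp add: norm_esym_eq_0_of_size_less)
  next
    case True
    define N where "N = real (size M) - real j"
    have N2: "1 \<le> N\<^sup>2" using True by (simp add: N_def one_le_power)
    have "0 \<le> real j * ((?E j)\<^sup>2 - ?E (j - 1) * ?E (Suc j))"
      using IH[of "j - 1"] by (cases j) simp_all
    then have "0 \<le> ((real j + 2) * a\<^sup>2) * (real j * ((?E j)\<^sup>2 - ?E (j - 1) * ?E (Suc j)))"
      by (intro mult_nonneg_nonneg[of "_ * a\<^sup>2"]) auto
    moreover have "0 \<le> (N\<^sup>2 - 1) * ((?E (Suc j))\<^sup>2 - ?E j * ?E (Suc (Suc j)))"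
      using N2 IH[of j] by simp
    ultimately have "0 \<le> (N\<^sup>2 - 1) * ((?E (Suc j))\<^sup>2 - ?E j * ?E (Suc (Suc j)))
        + real j * (real j + 2) * a\<^sup>2 * ((?E j)\<^sup>2 - ?E (j - 1) * ?E (Suc j))
        + (?E (Suc j) - a * ?E j)\<^sup>2"
      by (simp add: mult_ac)
    also have "\<dots> \<le> (real (size M) + 1)\<^sup>2 * ((?F (Suc j))\<^sup>2 - ?F j * ?F (Suc (Suc j)))"
      unfolding N_def by (rule norm_esym_add_mset_square_diff_ge[OF nn IH True])
    finally show ?thesis by (simp add: zero_le_mult_iff)
  qed
qed

text \<open>For the step to fail to be strict, every summand of the lower bound would have to vanish. The
  square vanishes only if \<open>E (Suc j) = a * E j\<close>. As the value after adding \<open>a\<close> is positive, all three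
  factors are then positive, which, if \<open>M\<close> is constant, makes \<open>a\<close> equal to its entries. Otherwise the induction hypothesis
  applies: at \<open>j\<close> if \<open>N > 1\<close>, and at \<open>j - 1\<close> if \<open>N = 1\<close>, where the defect at \<open>j\<close> has
  coefficient \<open>0\<close>.\<close>

theorem newton_ineq_strict:
  fixes M :: "real multiset"
  assumes "\<forall>a\<in>#M. 0 \<le> a" and "\<nexists>b. M = replicate_mset (size M) b"
    and "0 < norm_esym (Suc j) M"
  shows "norm_esym j M * norm_esym (Suc (Suc j)) M < (norm_esym (Suc j) M)\<^sup>2"
  using assms
proof (induction M arbitrary: j)
  case empty
  then show ?case by simp
next
  case (add a M)
  let ?E = "\<lambda>i. norm_esym i M" and ?F = "\<lambda>i. norm_esym i (add_mset a M)"
  have nn: "\<forall>b\<in>#M. 0 \<le> b" "0 \<le> a" using add.prems by auto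
  note weak = newton_ineq[OF nn(1)]
  show ?case
  proof (cases "Suc j \<le> size M")
    case False
    then show ?thesis using add.prems(3) by (simp add: norm_esym_eq_0_of_size_less)
  next
    case True
    define N where "N = real (size M) - real j"
    have N: "1 \<le> N" using True by (simp add: N_def)
    define A where "A = (N\<^sup>2 - 1) * ((?E (Suc j))\<^sup>2 - ?E j * ?E (Suc (Suc j)))"
    define B where "B = real j * (real j + 2) * a\<^sup>2 * ((?E j)\<^sup>2 - ?E (j - 1) * ?E (Suc j))"
    have A: "0 \<le> A"
      using N weak[of j] by (simp add: A_def one_le_power)
    have B: "0 \<le> B"
      using weak[of "j - 1"] by (cases j) (simp_all add: B_def)
    have "0 < A + B + (?E (Suc j) - a * ?E j)\<^sup>2"
    proof (cases "?E (Suc j) = a * ?E j")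
      case False
      then have "0 < (?E (Suc j) - a * ?E j)\<^sup>2" by simp
      then show ?thesis using A B by linarith
    next
      case eq: True
      have "?E (Suc j) \<noteq> 0"
      proof
        assume "?E (Suc j) = 0"
        then have "(real (size M) + 1) * ?F (Suc j) = 0"
          using norm_esym_add_mset[of M "Suc j" a] eq by auto
        then show False using add.prems(3) by simp
      qed
      then have pos: "0 < ?E (Suc j)" "0 < ?E j" "0 < a"
        using norm_esym_nonneg[OF nn(1)] nn(2) eq by (simp_all add: order_less_le)
      have nonconst: "\<nexists>b. M = replicate_mset (size M) b"
      proof
        assume "\<exists>b. M = replicate_mset (size M) b"
        then obtain b where b: "M = replicate_mset (size M) b" by blast
        have Eb: "?E i = b ^ i" if "i \<le> size M" for i
          by (subst b) (rule norm_esym_replicate_mset[OF that])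
        then have "b ^ Suc j = a * b ^ j" "b ^ j \<noteq> 0"
          using eq pos True by auto
        then have "b = a" by (metis mult_right_cancel power_Suc)
        then show False using add.prems(2) b by (metis replicate_mset_Suc size_add_mset)
      qed
      note IH = add.IH[OF nn(1) nonconst]
      show ?thesis
      proof (cases "N = 1")
        case False
        then have "0 < A"
          using N IH[OF pos(1)] by (simp add: A_def one_less_power)
        then show ?thesis using B by (simp add: add_pos_nonneg)
      next
        case True
        have "j \<noteq> 0"
        proof
          assume "j = 0"
          then have "size M = 1" using True by (simp add: N_def)
          then show False using nonconst by (metis One_nat_def replicate_mset_0 replicate_mset_Suc size_1_singleton_mset)
        qed
        then obtain l where l: "j = Suc l" by (cases j) auto
        then have "0 < B"
          using IH[of l] pos unfolding B_def l by (intro mult_pos_pos) auto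
        then show ?thesis using A by (simp add: add_nonneg_pos add_pos_nonneg)
      qed
    qed
    also have "\<dots> \<le> (real (size M) + 1)\<^sup>2 * ((?F (Suc j))\<^sup>2 - ?F j * ?F (Suc (Suc j)))"
      unfolding A_def B_def N_def by (rule norm_esym_add_mset_square_diff_ge[OF nn weak True])
    finally show ?thesis by (simp add: zero_less_mult_iff)
  qed
qed

section \<open>Roots and coefficients of convolution powers\<close>

lemma prod_linear_neq_0: "(\<Prod>a\<in>#M. [:- a, 1:]) \<noteq> (0 :: 'a::idom poly)"
  by (auto simp: prod_mset_zero_iff)

lemma degree_prod_linear: "degree (\<Prod>a\<in>#M. [:- a, 1 :: 'a::idom:]) = size M"
proof (induction M)
  case (add a M)
  then show ?case
    using degree_mult_eq[OF _ prod_linear_neq_0, of "[:- a, 1:]" M] by simp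
qed simp

lemma proots_prod_linear: "proots (\<Prod>a\<in>#M. [:- a, 1 :: 'a::idom:]) = M"
proof (induction M)
  case (add a M)
  then show ?case
    using proots_mult[OF _ prod_linear_neq_0, of "[:- a, 1:]" M] by simp
qed simp

lemma vieta:
  fixes M :: "'a::idom multiset"
  assumes "i \<le> size M"
  shows "signed_coeff (size M) (\<Prod>a\<in>#M. [:- a, 1:]) i = esym i M"
  using assms
proof (induction M arbitrary: i)
  case empty
  then show ?case by (simp add: signed_coeff_def)
next
  case (add a M)
  let ?q = "\<Prod>a\<in>#M. [:- a, 1:]"
  have top: "coeff ?q (Suc (size M)) = 0"
    by (simp add: coeff_eq_0 degree_prod_linear)
  show ?case
  proof (cases i)
    case 0
    then show ?thesis
      using add.IH[of 0] top by (simp add: signed_coeff_def)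
  next
    case (Suc j)
    then have j: "j \<le> size M" using add.prems by simp
    show ?thesis
    proof (cases "j = size M")
      case True
      then show ?thesis
        using add.IH[of j] by (simp add: Suc signed_coeff_def esym_Suc_add_mset
            esym_eq_0_of_size_less mult_ac)
    next
      case False
      then obtain l where l: "size M - j = Suc l" using j by (cases "size M - j") auto
      then have "size M - Suc j = l" by simp
      then show ?thesis
        using add.IH[of j] add.IH[of "Suc j"] False j l
        by (simp add: Suc signed_coeff_def esym_Suc_add_mset algebra_simps)
    qed
  qed
qed

text \<open>By the fundamental theorem of algebra there is a complex root, which is a non-negative real by
  hypothesis; split off its linear factor, and continue with the quotient, whose roots are among
  those of \<open>p\<close>.\<close>

lemma nonneg_real_rooted_factorization:
  assumes "lead_coeff p = 1" "nonneg_real_rooted p"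
  obtains M where "p = (\<Prod>a\<in>#M. [:- a, 1:])" "\<forall>a\<in>#M. 0 \<le> a"
  using assms
proof (induction "degree p" arbitrary: p thesis)
  case 0
  then have "p = 1" by (metis lead_coeff_1 degree_1 degree_0_id)
  then show ?case using "0.prems"(1)[of "{#}"] by simp
next
  case (Suc n)
  let ?c = "\<lambda>p. map_poly complex_of_real p"
  have "degree (?c p) = Suc n" using Suc.hyps(2) by (simp add: degree_map_poly)
  then obtain z where z: "poly (?c p) z = 0"
    using alg_closed_imp_poly_has_root[of "?c p"] by auto
  then have "z \<in> \<real>\<^sub>\<ge>\<^sub>0" using Suc.prems by (simp add: nonneg_real_rooted_def)
  then obtain a where a: "z = complex_of_real a" "0 \<le> a" by (auto elim: nonneg_Reals_cases)
  have "poly p a = 0"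
  proof -
    have "poly (?c p) (complex_of_real a) = complex_of_real (poly p a)"
      by (induction p) (auto simp: map_poly_pCons)
    then show ?thesis using z by (simp add: a)
  qed
  then obtain q where q: "p = [:- a, 1:] * q"
    by (metis dvd_def poly_eq_0_iff_dvd)
  have "q \<noteq> 0" using q Suc.prems by auto
  then have "degree q = n" using Suc.hyps(2) unfolding q by (subst (asm) degree_mult_eq) auto
  moreover have "lead_coeff q = 1" using Suc.prems(2) unfolding q lead_coeff_mult by simp
  moreover have "nonneg_real_rooted q"
    unfolding nonneg_real_rooted_def
  proof (intro allI impI)
    fix w assume "poly (?c q) w = 0"
    moreover have "?c p = ?c [:- a, 1:] * ?c q" unfolding q
      by (intro poly_eqI) (auto simp: map_poly_pCons coeff_map_poly coeff_pCons split: nat.splits)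
    ultimately show "w \<in> \<real>\<^sub>\<ge>\<^sub>0"
      using Suc.prems by (simp add: nonneg_real_rooted_def)
  qed
  ultimately obtain M where "q = (\<Prod>a\<in>#M. [:- a, 1:])" "\<forall>a\<in>#M. 0 \<le> a"
    using Suc.hyps(1) by metis
  then show ?case using Suc.prems(1)[of "add_mset a M"] q a(2) by simp
qed

lemma degree_ff_mult_conv: "degree (ff_mult_conv d p q) \<le> d"
  unfolding ff_mult_conv_def by (intro degree_sum_le) (auto intro: order_trans[OF degree_monom_le])

lemma signed_coeff_ff_mult_conv:
  assumes "i \<le> d"
  shows "signed_coeff d (ff_mult_conv d p q) i =
    signed_coeff d p i * signed_coeff d q i / of_nat (d choose i)"
proof -
  have "coeff (ff_mult_conv d p q) (d - i) = (\<Sum>j=0..d. if i = j then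
      (-1) ^ i * (signed_coeff d p i * signed_coeff d q i / of_nat (d choose i)) else 0)"
    unfolding ff_mult_conv_def coeff_sum coeff_monom using assms by (intro sum.cong) auto
  also have "\<dots> = (-1) ^ i * (signed_coeff d p i * signed_coeff d q i / of_nat (d choose i))"
    using assms by simp
  finally show ?thesis
    by (simp add: signed_coeff_def[of d "ff_mult_conv d p q"] flip: mult.assoc power_mult_distrib)
qed

lemma degree_ff_mult_power:
  assumes "degree p \<le> d"
  shows "degree (ff_mult_power d p n) \<le> d"
  using assms by (induction d p n rule: ff_mult_power.induct)
    (auto intro: degree_ff_mult_conv order_trans[OF degree_power_le])

text \<open>Division by the binomial coefficient in the convolution makes the normalised coefficients
  multiplicative.\<close>

lemma signed_coeff_ff_mult_power:
  assumes "1 \<le> n" "i \<le> d" "signed_coeff d p i = of_nat (d choose i) * e"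
  shows "signed_coeff d (ff_mult_power d p n) i = of_nat (d choose i) * e ^ n"
  using assms(1)
proof (induction n rule: nat_induct_at_least)
  case base
  then show ?case using assms(3) by simp
next
  case (Suc n)
  then have "ff_mult_power d p (Suc n) = ff_mult_conv d (ff_mult_power d p n) p"
    by (cases n) auto
  then show ?case using Suc assms by (simp add: signed_coeff_ff_mult_conv)
qed

lemma poly_eq_sum_signed_coeff:
  assumes "degree q \<le> d"
  shows "poly q x = (\<Sum>i\<le>d. (-1) ^ i * signed_coeff d q i * x ^ (d - i))"
proof -
  have "poly q x = (\<Sum>i\<le>degree q. coeff q i * x ^ i)" by (rule poly_altdef)
  also have "\<dots> = (\<Sum>i\<le>d. coeff q i * x ^ i)"
    using assms by (intro sum.mono_neutral_left) (auto simp: coeff_eq_0)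
  also have "\<dots> = (\<Sum>i\<le>d. coeff q (d - i) * x ^ (d - i))"
    using sum.nat_diff_reindex[of "\<lambda>i. coeff q i * x ^ i" "Suc d"]
    by (simp add: lessThan_Suc_atMost)
  finally show ?thesis
    by (simp add: signed_coeff_def flip: mult.assoc power_mult_distrib)
qed

lemma poly_eqI_signed_coeff:
  assumes "degree p \<le> d" "degree q \<le> d"
    and "\<And>i. i \<le> d \<Longrightarrow> signed_coeff d p i = signed_coeff d q i"
  shows "p = q"
proof (rule poly_eqI)
  fix n
  show "coeff p n = coeff q n"
  proof (cases "n \<le> d")
    case True
    then have "(-1) ^ (d - n) * coeff p n = (-1) ^ (d - n) * coeff q n"
      using assms(3)[of "d - n"] by (simp add: signed_coeff_def)
    then have "(-1) ^ (d - n) * ((-1) ^ (d - n) * coeff p n) =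
        (-1) ^ (d - n) * ((-1) ^ (d - n) * coeff q n)"
      by simp
    then show ?thesis by (simp flip: mult.assoc power_mult_distrib)
  qed (use assms in \<open>simp add: coeff_eq_0\<close>)
qed

section \<open>Signs at separating points\<close>

lemma less_peak:
  fixes f :: "nat \<Rightarrow> real"
  assumes up: "\<And>l. l < i \<Longrightarrow> f l < f (Suc l)"
    and down: "\<And>l. i \<le> l \<Longrightarrow> l < m \<Longrightarrow> f (Suc l) < f l"
    and "j \<noteq> i" "j \<le> m"
  shows "f j < f i"
proof (cases "j < i")
  case True
  then show ?thesis
    using up by (induction rule: strict_inc_induct) (auto intro: less_trans)
next
  case False
  then have "i < j" using \<open>j \<noteq> i\<close> by simp
  then show ?thesis using \<open>j \<le> m\<close>
  proof (induction j)
    case (Suc j)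
    then show ?case
      using down[of j] by (cases "j = i") (auto intro: less_trans)
  qed simp
qed

text \<open>Divided by the \<open>n\<close>-th power of the dominating value \<open>E i * t ^ (d - i)\<close>, the sum converges to
  its \<open>i\<close>-th term \<open>(-1) ^ i * (d choose i)\<close>, for all other terms decay geometrically.\<close>

lemma dominant_term_sign:
  fixes E :: "nat \<Rightarrow> real" and t :: real
  assumes "0 < t" "i \<le> d" "0 < E i" and nonneg: "\<And>j. 0 \<le> E j"
    and dom: "\<And>j. j \<le> d \<Longrightarrow> j \<noteq> i \<Longrightarrow> E j * t ^ (d - j) < E i * t ^ (d - i)"
  shows "\<forall>\<^sub>F n in sequentially.
    0 < (-1) ^ i * (\<Sum>j\<le>d. (-1) ^ j * (real (d choose j) * E j ^ n) * (t ^ n) ^ (d - j))"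
proof -
  define D where "D = E i * t ^ (d - i)"
  have D: "0 < D" using assms by (simp add: D_def)
  define g where "g = (\<lambda>j. E j * t ^ (d - j) / D)"
  have g: "(\<lambda>n. g j ^ n) \<longlonglongrightarrow> (if j = i then 1 else 0)" if "j \<le> d" for j
  proof (cases "j = i")
    case True
    then have "g j = 1" using D by (simp add: g_def flip: D_def)
    then show ?thesis using True by simp
  next
    case False
    have "\<bar>g j\<bar> < 1"
      using dom[OF that False] D nonneg[of j] \<open>0 < t\<close> by (simp add: g_def D_def[symmetric])
    then show ?thesis using False by (simp add: LIMSEQ_power_zero)
  qed
  have "(\<lambda>n. (-1) ^ i * (\<Sum>j\<le>d. (-1) ^ j * real (d choose j) * g j ^ n)) \<longlonglongrightarrow>
      (-1) ^ i * (\<Sum>j\<le>d. (-1) ^ j * real (d choose j) * (if j = i then 1 else 0))"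
    by (intro tendsto_intros g) auto
  also have "(\<Sum>j\<le>d. (-1) ^ j * real (d choose j) * (if j = i then 1 else 0)) =
      (\<Sum>j\<le>d. if j = i then (-1) ^ j * real (d choose j) else 0)"
    by (intro sum.cong) auto
  also have "(-1) ^ i * \<dots> = real (d choose i)"
    using \<open>i \<le> d\<close> by (simp flip: mult.assoc power_mult_distrib)
  finally have "\<forall>\<^sub>F n in sequentially. 0 < (-1) ^ i * (\<Sum>j\<le>d. (-1) ^ j * real (d choose j) * g j ^ n)"
    using \<open>i \<le> d\<close> by (intro order_tendstoD) auto
  then show ?thesis
  proof eventually_elim
    case (elim n)
    have "(\<Sum>j\<le>d. (-1) ^ j * (real (d choose j) * E j ^ n) * (t ^ n) ^ (d - j)) =
        D ^ n * (\<Sum>j\<le>d. (-1) ^ j * real (d choose j) * g j ^ n)"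
      unfolding sum_distrib_left
    proof (rule sum.cong[OF refl])
      fix j
      have "D ^ n * g j ^ n = E j ^ n * (t ^ n) ^ (d - j)"
        using D by (simp add: g_def power_mult_distrib power_divide mult.commute flip: power_mult)
      then show "(-1) ^ j * (real (d choose j) * E j ^ n) * (t ^ n) ^ (d - j) =
          D ^ n * ((-1) ^ j * real (d choose j) * g j ^ n)"
        by (simp add: mult_ac)
    qed
    then have eq: "(-1) ^ i * (\<Sum>j\<le>d. (-1) ^ j * (real (d choose j) * E j ^ n) * (t ^ n) ^ (d - j)) =
        D ^ n * ((-1) ^ i * (\<Sum>j\<le>d. (-1) ^ j * real (d choose j) * g j ^ n))"
      by (simp add: mult_ac)
    show ?case unfolding eq by (rule mult_pos_pos[OF zero_less_power[OF D] elim])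
  qed
qed

text \<open>The points \<open>t 0 > r\<^sub>1 > t 1 > r\<^sub>2 > \<dots> > r\<^sub>m > t m > 0\<close> interlace with the ratios
  \<open>r\<^sub>j = E j / E (j - 1)\<close>.\<close>

definition separating :: "nat \<Rightarrow> (nat \<Rightarrow> real) \<Rightarrow> (nat \<Rightarrow> real) \<Rightarrow> bool" where
  "separating m E t \<longleftrightarrow> 0 < t m \<and> (\<forall>j<m. t (Suc j) < E (Suc j) / E j \<and> E (Suc j) / E j < t j)"

lemma separating_antimono:
  assumes "separating m E t" "i \<le> j" "j \<le> m"
  shows "t j \<le> t i"
  using assms(2,3)
proof (induction j rule: dec_induct)
  case (step j)
  then have "t (Suc j) < t j" using assms(1) unfolding separating_def
    by (metis Suc_le_lessD less_trans)
  then show ?case using step by simp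
qed simp

lemma separating_pos:
  assumes "separating m E t" "j \<le> m"
  shows "0 < t j"
  using separating_antimono[OF assms(1) assms(2) order_refl] assms(1)
  by (simp add: separating_def)

text \<open>From the index \<open>j\<close> to \<open>j + 1\<close> the value \<open>E j * t i ^ (d - j)\<close> is multiplied by
  \<open>r\<^sub>j\<^sub>+\<^sub>1 / t i\<close>, which is above \<open>1\<close> for \<open>j < i\<close> and below \<open>1\<close> for \<open>j \<ge> i\<close>. So the values rise up
  to \<open>j = i\<close> and fall from there on.\<close>

lemma separating_dominant:
  fixes E :: "nat \<Rightarrow> real"
  assumes sep: "separating m E t" and "m \<le> d"
    and pos: "\<And>j. j \<le> m \<Longrightarrow> 0 < E j" and zero: "\<And>j. m < j \<Longrightarrow> E j = 0"
    and "i \<le> m" "j \<le> d" "j \<noteq> i"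
  shows "E j * t i ^ (d - j) < E i * t i ^ (d - i)"
proof (cases "j \<le> m")
  case False
  then show ?thesis
    using pos[of i] zero[of j] separating_pos[OF sep \<open>i \<le> m\<close>] \<open>i \<le> m\<close> by simp
next
  case True
  have ti: "0 < t i" using separating_pos[OF sep \<open>i \<le> m\<close>] .
  have d: "d - l = Suc (d - Suc l)" if "l < m" for l using that \<open>m \<le> d\<close> by simp
  show ?thesis
  proof (rule less_peak[where f = "\<lambda>j. E j * t i ^ (d - j)" and m = m])
    fix l assume l: "l < i"
    then have "t i \<le> t (Suc l)" "t (Suc l) < E (Suc l) / E l"
      using sep separating_antimono[OF sep, of "Suc l" i] \<open>i \<le> m\<close> by (auto simp: separating_def)
    then have "t i < E (Suc l) / E l" by simp
    then have "E l * t i < E (Suc l)"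
      using pos[of l] l \<open>i \<le> m\<close> by (simp add: field_simps)
    then show "E l * t i ^ (d - l) < E (Suc l) * t i ^ (d - Suc l)"
      using ti l \<open>i \<le> m\<close> by (simp add: d flip: mult.assoc)
  next
    fix l assume l: "i \<le> l" "l < m"
    then have "E (Suc l) / E l < t l" "t l \<le> t i"
      using sep separating_antimono[OF sep, of i l] by (auto simp: separating_def)
    then have "E (Suc l) / E l < t i" by simp
    then have "E (Suc l) < E l * t i"
      using pos[of l] l by (simp add: field_simps)
    then show "E (Suc l) * t i ^ (d - Suc l) < E l * t i ^ (d - l)"
      using ti l by (simp add: d flip: mult.assoc)
  qed (use True \<open>j \<noteq> i\<close> in auto)
qed

section \<open>Locating the roots\<close>

lemma desc_root_eq_nth:
  assumes "proots q = mset xs"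
    and "\<And>i j. i \<le> j \<Longrightarrow> j < length xs \<Longrightarrow> xs ! j \<le> xs ! i"
  shows "desc_root q i = xs ! (i - 1)"
proof -
  have "sort xs = rev xs"
    by (rule properties_for_sort) (use assms(2) in \<open>auto simp: sorted_rev_iff_nth_mono\<close>)
  then show ?thesis by (simp add: desc_root_def assms(1))
qed

text \<open>The intermediate value theorem yields \<open>m\<close> distinct positive roots, one per interval, and the
  vanishing low coefficients make \<open>0\<close> a root of order at least \<open>k\<close>. As the degree is \<open>m + k\<close>,
  there is no room for further roots or multiplicities, so the multiset of roots is known.\<close>

lemma sign_changes_locate_roots:
  fixes q :: "real poly" and T :: "nat \<Rightarrow> real"
  assumes "degree q = m + k" and zeros: "\<And>c. c < k \<Longrightarrow> coeff q c = 0"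
    and "0 < T m" and dec: "\<And>j. j < m \<Longrightarrow> T (Suc j) < T j"
    and sign: "\<And>j. j \<le> m \<Longrightarrow> 0 < (-1) ^ j * poly q (T j)"
  shows "\<forall>i<m. T (Suc i) < desc_root q (Suc i) \<and> desc_root q (Suc i) < T i"
    and "\<forall>i. m \<le> i \<and> i < m + k \<longrightarrow> desc_root q (Suc i) = 0"
proof -
  have q0: "q \<noteq> 0" using sign[of 0] by auto
  have "\<exists>y>T (Suc j). y < T j \<and> poly q y = 0" if "j < m" for j
  proof (rule poly_IVT[OF dec[OF that]])
    have "0 < ((-1) ^ j * poly q (T j)) * ((-1) ^ Suc j * poly q (T (Suc j)))"
      by (rule mult_pos_pos[OF sign sign]) (use that in auto)
    also have "\<dots> = - ((-1) ^ j * (-1) ^ j) * (poly q (T (Suc j)) * poly q (T j))"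
      by (simp add: mult_ac)
    also have "\<dots> = - (poly q (T (Suc j)) * poly q (T j))"
      by (simp flip: power_mult_distrib)
    finally show "poly q (T (Suc j)) * poly q (T j) < 0" by simp
  qed
  then obtain x where x: "\<And>j. j < m \<Longrightarrow> T (Suc j) < x j \<and> x j < T j \<and> poly q (x j) = 0"
    by metis
  have antimono: "T j \<le> T i" if "i \<le> j" "j \<le> m" for i j
    using that
  proof (induction j rule: dec_induct)
    case (step j)
    then show ?case using dec[of j] by simp
  qed simp
  have x_less: "x j < x i" if "i < j" "j < m" for i j
    using x[of i] x[of j] antimono[of "Suc i" j] that by auto
  have x_pos: "0 < x j" if "j < m" for j
    using x[OF that] antimono[of "Suc j" m] \<open>0 < T m\<close> that by auto
  define xs where "xs = map x [0..<m] @ replicate k 0"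
  have inj: "inj_on x {0..<m}"
    by (rule inj_onI) (metis x_less atLeastLessThan_iff linorder_neqE_nat less_irrefl)
  have "mset xs \<subseteq># proots q"
  proof (rule mset_subset_eqI)
    fix a
    show "count (mset xs) a \<le> count (proots q) a"
    proof (cases "a = 0")
      case True
      have "0 \<notin> x ` {0..<m}" using x_pos by force
      then have "count (mset xs) a = k"
        using True by (simp add: xs_def count_eq_zero_iff)
      moreover have "k \<le> order 0 q"
        using zeros q0 by (simp add: monom_1_dvd_iff' flip: monom_1_dvd_iff)
      ultimately show ?thesis using True q0 by simp
    next
      case False
      have "distinct (map x [0..<m])" using inj by (simp add: distinct_map)
      then have "count (mset xs) a = (if a \<in> x ` {0..<m} then 1 else 0)"
        using False by (simp add: xs_def distinct_count_atmost_1 del: mset_map)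
      moreover have "0 < order a q" if "a \<in> x ` {0..<m}"
        using that x q0 by (auto simp: order_gt_0_iff)
      ultimately show ?thesis using q0 by auto
    qed
  qed
  moreover have "size (proots q) \<le> size (mset xs)"
    using size_proots_le[of q] \<open>degree q = m + k\<close> by (simp add: xs_def)
  ultimately have "proots q = mset xs"
    by (metis mset_subset_size not_less subset_mset.le_less)
  moreover have "xs ! j \<le> xs ! i" if "i \<le> j" "j < length xs" for i j
    using that x_less[of i j] x_pos[of i] 
    by (cases "i = j") (auto simp: xs_def nth_append less_imp_le)
  ultimately have root: "desc_root q i = xs ! (i - 1)" for i
    by (rule desc_root_eq_nth)
  show "\<forall>i<m. T (Suc i) < desc_root q (Suc i) \<and> desc_root q (Suc i) < T i"
    using x by (simp add: root xs_def nth_append)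
  show "\<forall>i. m \<le> i \<and> i < m + k \<longrightarrow> desc_root q (Suc i) = 0"
    by (auto simp: root xs_def nth_append)
qed

text \<open>For large \<open>n\<close>, the signs at all of the finitely many points \<open>t i ^ n\<close> are as predicted by the
  dominating term; then \<open>sign_changes_locate_roots\<close> applies to these points.\<close>

lemma desc_root_between_separating:
  fixes E :: "nat \<Rightarrow> real" and P :: "nat \<Rightarrow> real poly"
  assumes deg: "\<And>n. degree (P n) \<le> m + k"
    and coeff: "\<And>n i. 1 \<le> n \<Longrightarrow> i \<le> m + k \<Longrightarrow>
      signed_coeff (m + k) (P n) i = real ((m + k) choose i) * E i ^ n"
    and pos: "\<And>j. j \<le> m \<Longrightarrow> 0 < E j" and zero: "\<And>j. m < j \<Longrightarrow> E j = 0"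
    and sep: "separating m E t"
  shows "\<forall>\<^sub>F n in sequentially.
    (\<forall>i<m. t (Suc i) < root n (desc_root (P n) (Suc i)) \<and> root n (desc_root (P n) (Suc i)) < t i) \<and>
    (\<forall>i. m \<le> i \<and> i < m + k \<longrightarrow> desc_root (P n) (Suc i) = 0)"
proof -
  let ?d = "m + k"
  have nonneg: "0 \<le> E j" for j using pos[of j] zero[of j] by (cases "j \<le> m") auto
  have "\<forall>\<^sub>F n in sequentially. \<forall>i\<in>{..m}. 0 < (-1) ^ i *
      (\<Sum>j\<le>?d. (-1) ^ j * (real (?d choose j) * E j ^ n) * (t i ^ n) ^ (?d - j))"
  proof (intro eventually_ball_finite ballI)
    fix i assume "i \<in> {..m}"
    then show "\<forall>\<^sub>F n in sequentially. 0 < (-1) ^ i *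
        (\<Sum>j\<le>?d. (-1) ^ j * (real (?d choose j) * E j ^ n) * (t i ^ n) ^ (?d - j))"
      using separating_dominant[OF sep _ pos zero, of ?d i]
      by (intro dominant_term_sign separating_pos[OF sep] pos nonneg) auto
  qed simp
  then show ?thesis
    using eventually_ge_at_top[of 1]
  proof eventually_elim
    case (elim n)
    have coeff_n: "signed_coeff ?d (P n) i = real (?d choose i) * E i ^ n" if "i \<le> ?d" for i
      using coeff elim(2) that by simp
    have "coeff (P n) ?d \<noteq> 0"
      using coeff_n[of 0] pos[of 0] by (auto simp: signed_coeff_def)
    then have degree: "degree (P n) = ?d"
      using deg[of n] le_degree[of "P n" ?d] by simp
    have zeros: "coeff (P n) c = 0" if "c < k" for c
      using coeff_n[of "?d - c"] zero[of "?d - c"] that elim(2)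
      by (simp add: signed_coeff_def power_0_left)
    have sign: "0 < (-1) ^ i * poly (P n) (t i ^ n)" if "i \<le> m" for i
      using elim(1) that by (simp add: poly_eq_sum_signed_coeff[OF deg] coeff_n)
    have dec: "t (Suc j) ^ n < t j ^ n" if "j < m" for j
      using that sep separating_pos[OF sep, of "Suc j"] elim(2)
      by (intro power_strict_mono) (auto simp: separating_def intro: less_trans)
    have root_cancel: "root n (t j ^ n) = t j" if "j \<le> m" for j
      using separating_pos[OF sep that] elim(2) by (simp add: real_root_power_cancel)
    note loc = sign_changes_locate_roots[where T = "\<lambda>j. t j ^ n", OF degree zeros _ dec sign]
    have tm: "0 < t m ^ n" using separating_pos[OF sep, of m] by simp
    have "t (Suc i) < root n (desc_root (P n) (Suc i)) \<and> root n (desc_root (P n) (Suc i)) < t i"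
      if "i < m" for i
      using loc(1)[OF _ tm] that elim(2) root_cancel[of i] root_cancel[of "Suc i"]
        real_root_less_mono[of n "t (Suc i) ^ n" "desc_root (P n) (Suc i)"]
        real_root_less_mono[of n "desc_root (P n) (Suc i)" "t i ^ n"] by auto
    then show ?case using loc(2)[OF _ tm] by simp
  qed
qed

text \<open>Take the midpoints of consecutive ratios, and any point above the first ratio. The last midpoint
  is that of \<open>r\<^sub>m\<close> and \<open>r\<^sub>m\<^sub>+\<^sub>1 = 0\<close>, hence positive.\<close>

lemma separating_exists:
  fixes E :: "nat \<Rightarrow> real"
  assumes pos: "\<And>j. j \<le> m \<Longrightarrow> 0 < E j" and zero: "\<And>j. m < j \<Longrightarrow> E j = 0"
    and logconcave: "\<And>j. j < m \<Longrightarrow> E j * E (Suc (Suc j)) < (E (Suc j))\<^sup>2"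
  obtains t where "separating m E t"
proof -
  define r where "r = (\<lambda>j. E (Suc j) / E j)"
  have r_dec: "r (Suc j) < r j" if "j < m" for j
    using logconcave[OF that] pos[of j] pos[of "Suc j"] that
    by (simp add: r_def field_simps power2_eq_square)
  have r_nonneg: "0 \<le> r j" if "j \<le> m" for j
    using pos[of j] pos[of "Suc j"] zero[of "Suc j"] that by (cases "j = m") (auto simp: r_def)
  \<comment> \<open>With \<open>r j = E (Suc j) / E j\<close>, the point \<open>t (Suc l)\<close> has to lie between \<open>r (Suc l)\<close> and \<open>r l\<close>.\<close>
  define t where "t = (\<lambda>j. case j of 0 \<Rightarrow> r 0 + 1 | Suc l \<Rightarrow> (r l + r (Suc l)) / 2)"
  have above: "r j < t j" if "j \<le> m" for j
    using r_dec[of "j - 1"] that by (cases j) (auto simp: t_def field_simps)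
  have below: "t (Suc j) < r j" if "j < m" for j
    using r_dec[OF that] by (simp add: t_def)
  have "0 < t m" using above[of m] r_nonneg[of m] by simp
  then have "separating m E t"
    using above below by (auto simp: separating_def r_def)
  then show thesis ..
qed

text \<open>Given separating points, moving the one just below (above) a ratio closer to that ratio leaves
  them separating. So every lower (upper) bound of the ratio eventually bounds the \<open>n\<close>-th roots.\<close>

lemma tendsto_root_desc_root:
  fixes E :: "nat \<Rightarrow> real" and P :: "nat \<Rightarrow> real poly"
  assumes deg: "\<And>n. degree (P n) \<le> m + k"
    and coeff: "\<And>n i. 1 \<le> n \<Longrightarrow> i \<le> m + k \<Longrightarrow>
      signed_coeff (m + k) (P n) i = real ((m + k) choose i) * E i ^ n"
    and pos: "\<And>j. j \<le> m \<Longrightarrow> 0 < E j" and zero: "\<And>j. m < j \<Longrightarrow> E j = 0"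
    and logconcave: "\<And>j. j < m \<Longrightarrow> E j * E (Suc (Suc j)) < (E (Suc j))\<^sup>2"
  shows "i < m \<Longrightarrow> (\<lambda>n. root n (desc_root (P n) (Suc i))) \<longlonglongrightarrow> E (Suc i) / E i"
    and "m \<le> i \<Longrightarrow> i < m + k \<Longrightarrow> (\<lambda>n. root n (desc_root (P n) (Suc i))) \<longlonglongrightarrow> 0"
proof -
  obtain t where t: "separating m E t"
    using separating_exists[of m E, OF pos zero logconcave] by blast
  have between: "\<forall>\<^sub>F n in sequentially.
      (\<forall>i<m. s (Suc i) < root n (desc_root (P n) (Suc i)) \<and>
        root n (desc_root (P n) (Suc i)) < s i) \<and>
      (\<forall>i. m \<le> i \<and> i < m + k \<longrightarrow> desc_root (P n) (Suc i) = 0)" if "separating m E s" for s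
    by (rule desc_root_between_separating) (use deg coeff pos zero that in auto)
  show "(\<lambda>n. root n (desc_root (P n) (Suc i))) \<longlonglongrightarrow> E (Suc i) / E i" if i: "i < m"
  proof (rule order_tendstoI)
    fix a assume a: "a < E (Suc i) / E i"
    have sep: "separating m E (t(Suc i := max a (t (Suc i))))"
      using t i a by (auto simp: separating_def less_max_iff_disj)
    show "\<forall>\<^sub>F n in sequentially. a < root n (desc_root (P n) (Suc i))"
      by (rule eventually_mono[OF between[OF sep]]) (use i in auto)
  next
    fix b assume b: "E (Suc i) / E i < b"
    have sep: "separating m E (t(i := min b (t i)))"
      using t i b by (auto simp: separating_def min_less_iff_disj)
    show "\<forall>\<^sub>F n in sequentially. root n (desc_root (P n) (Suc i)) < b"
      by (rule eventually_mono[OF between[OF sep]]) (use i in auto)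
  qed
  show "(\<lambda>n. root n (desc_root (P n) (Suc i))) \<longlonglongrightarrow> 0" if "m \<le> i" "i < m + k"
  proof (rule tendsto_eventually)
    show "\<forall>\<^sub>F n in sequentially. root n (desc_root (P n) (Suc i)) = 0"
      by (rule eventually_mono[OF between[OF t]]) (use that in auto)
  qed
qed

text \<open>The one case where Newton's inequalities are equalities is explicit: the convolution powers of
  \<open>(x - a)^d\<close> are the polynomials \<open>(x - a^n)^d\<close>, since the normalised elementary symmetric
  polynomials of \<open>d\<close> copies of \<open>a\<close> are the powers of \<open>a\<close>.\<close>

lemma ff_mult_power_linear_power:
  fixes a :: real
  assumes "1 \<le> n"
  shows "ff_mult_power d (\<Prod>b\<in>#replicate_mset d a. [:- b, 1:]) n =
    (\<Prod>b\<in>#replicate_mset d (a ^ n). [:- b, 1:])"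
proof (rule poly_eqI_signed_coeff[where d = d])
  have vieta': "signed_coeff d (\<Prod>b\<in>#replicate_mset d c. [:- b, 1:]) i = real (d choose i) * c ^ i"
    if "i \<le> d" for c i
    using vieta[of i "replicate_mset d c"] that by (simp add: esym_replicate_mset)
  have deg: "degree (\<Prod>b\<in>#replicate_mset d c. [:- b, 1:]) = d" for c :: real
    using degree_prod_linear[of "replicate_mset d c"] by simp
  show "degree (ff_mult_power d (\<Prod>b\<in>#replicate_mset d a. [:- b, 1:]) n) \<le> d"
    by (rule degree_ff_mult_power) (simp only: deg)
  show "degree (\<Prod>b\<in>#replicate_mset d (a ^ n). [:- b, 1:]) \<le> d"
    by (simp only: deg)
  fix i assume i: "i \<le> d"
  show "signed_coeff d (ff_mult_power d (\<Prod>b\<in>#replicate_mset d a. [:- b, 1:]) n) i =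
      signed_coeff d (\<Prod>b\<in>#replicate_mset d (a ^ n). [:- b, 1:]) i"
    using signed_coeff_ff_mult_power[OF assms i vieta'[OF i]] vieta'[OF i]
    by (simp add: mult.commute flip: power_mult)
qed

theorem theorem1p1:
  fixes p :: "real poly" and d k :: nat and \<Lambda> :: "real multiset"
  assumes "d \<ge> 1"
    and "degree p = d"
    and "lead_coeff p = 1"
    and "nonneg_real_rooted p"
    and "\<Lambda> = proots p"
    and "k = count \<Lambda> 0"
  shows "(\<forall>i. 1 \<le> i \<and> i \<le> d - k \<longrightarrow>
            (\<lambda>n. root n (desc_root (ff_mult_power d p n) i))
              \<longlonglongrightarrow> norm_esym i \<Lambda> / norm_esym (i - 1) \<Lambda>) \<and>
         (\<forall>i. d - k + 1 \<le> i \<and> i \<le> d \<longrightarrow>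
            (\<lambda>n. root n (desc_root (ff_mult_power d p n) i)) \<longlonglongrightarrow> 0)"
proof -
  obtain M where M: "p = (\<Prod>a\<in>#M. [:- a, 1:])" "\<forall>a\<in>#M. 0 \<le> a"
    using nonneg_real_rooted_factorization assms(3,4) by blast
  have \<Lambda>: "\<Lambda> = M" by (simp only: assms(5) M(1) proots_prod_linear)
  have d: "size \<Lambda> = d" by (simp only: \<Lambda> M(1) degree_prod_linear flip: assms(2))
  define m where "m = d - k"
  have mk: "m + k = d"
    using count_le_size[of \<Lambda> 0] d assms(6) by (simp add: m_def)
  define E where "E = (\<lambda>i. norm_esym i \<Lambda>)"
  have E_pos_iff: "0 < E j \<longleftrightarrow> j \<le> m" for j
    using norm_esym_pos_iff[OF M(2), of j] mk d assms(6) by (auto simp: E_def \<Lambda>)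
  then have pos: "\<And>j. j \<le> m \<Longrightarrow> 0 < E j" by simp
  have zero: "E j = 0" if "m < j" for j
    using E_pos_iff[of j] norm_esym_nonneg[OF M(2), of j] that by (auto simp: E_def \<Lambda>)
  have deg: "degree (ff_mult_power d p n) \<le> m + k" for n
    using degree_ff_mult_power[of p d n] assms(2) mk by simp
  have coeff: "signed_coeff (m + k) (ff_mult_power d p n) i = real ((m + k) choose i) * E i ^ n"
    if "1 \<le> n" "i \<le> m + k" for n i
  proof -
    have "signed_coeff d p i = real (d choose i) * E i"
      using vieta[of i M] d \<Lambda> M(1) that mk
      by (simp add: E_def esym_eq_choose_mult_norm_esym)
    then show ?thesis using signed_coeff_ff_mult_power that mk by simp
  qed
  have "(\<forall>i<m. (\<lambda>n. root n (desc_root (ff_mult_power d p n) (Suc i))) \<longlonglongrightarrow> E (Suc i) / E i) \<and>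
    (\<forall>i. m \<le> i \<and> i < m + k \<longrightarrow>
      (\<lambda>n. root n (desc_root (ff_mult_power d p n) (Suc i))) \<longlonglongrightarrow> 0)"
  \<comment> \<open>If all roots are \<open>0\<close>, then \<open>m = 0\<close> and there is no strict inequality to prove, so this belongs
    to the generic case.\<close>
  proof (cases "m = 0 \<or> (\<nexists>b. \<Lambda> = replicate_mset (size \<Lambda>) b)")
    case True
    have logconcave: "E j * E (Suc (Suc j)) < (E (Suc j))\<^sup>2" if "j < m" for j
      using newton_ineq_strict[of \<Lambda> j] True M(2) pos[of "Suc j"] that by (auto simp: E_def \<Lambda>)
    show ?thesis
      using tendsto_root_desc_root[OF deg coeff pos zero logconcave] by blast
  next
    case False
    then obtain b where b: "\<Lambda> = replicate_mset d b" and "0 < m" using d by auto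
    have "b \<noteq> 0"
      using b assms(6) mk \<open>0 < m\<close> by auto
    then have "k = 0" using b assms(6) by simp
    have "0 < b" using \<open>b \<noteq> 0\<close> M(2) b assms(1) by (auto simp: \<Lambda> order_less_le)
    have root: "root n (desc_root (ff_mult_power d p n) (Suc i)) = b" if "1 \<le> n" "i < d" for n i
    proof -
      have "proots (ff_mult_power d p n) = mset (replicate d (b ^ n))"
        using ff_mult_power_linear_power[OF that(1), of d b] b M(1)
        by (simp only: \<Lambda> proots_prod_linear mset_replicate)
      then have "desc_root (ff_mult_power d p n) (Suc i) = replicate d (b ^ n) ! (Suc i - 1)"
        by (rule desc_root_eq_nth) simp
      then show ?thesis using that \<open>0 < b\<close> by (simp add: real_root_power_cancel)
    qed
    have "(\<lambda>n. root n (desc_root (ff_mult_power d p n) (Suc i))) \<longlonglongrightarrow> E (Suc i) / E i"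
      if "i < m" for i
    proof (rule tendsto_eventually)
      have eq: "E (Suc i) / E i = b"
        using that mk \<open>b \<noteq> 0\<close> by (simp add: E_def b norm_esym_replicate_mset)
      show "\<forall>\<^sub>F n in sequentially. root n (desc_root (ff_mult_power d p n) (Suc i)) =
          E (Suc i) / E i"
        by (rule eventually_mono[OF eventually_ge_at_top[of 1]]) (use root eq that mk in auto)
    qed
    then show ?thesis using \<open>k = 0\<close> by auto
  qed
  then have *: "\<And>i. i < m \<Longrightarrow>
      (\<lambda>n. root n (desc_root (ff_mult_power d p n) (Suc i))) \<longlonglongrightarrow> E (Suc i) / E i"
    "\<And>i. m \<le> i \<Longrightarrow> i < m + k \<Longrightarrow>
      (\<lambda>n. root n (desc_root (ff_mult_power d p n) (Suc i))) \<longlonglongrightarrow> 0"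
    by blast+
  show ?thesis
  proof (intro conjI allI impI)
    fix i assume "1 \<le> i \<and> i \<le> d - k"
    then show "(\<lambda>n. root n (desc_root (ff_mult_power d p n) i))
        \<longlonglongrightarrow> norm_esym i \<Lambda> / norm_esym (i - 1) \<Lambda>"
      using *(1)[of "i - 1"] by (cases i) (auto simp: m_def E_def)
  next
    fix i assume "d - k + 1 \<le> i \<and> i \<le> d"
    then show "(\<lambda>n. root n (desc_root (ff_mult_power d p n) i)) \<longlonglongrightarrow> 0"
      using *(2)[of "i - 1"] mk by (cases i) (auto simp: m_def)
  qed
qed

end
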